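(* Let $\mathfrak{g}$ be the insertion-elimination algebra, and let $\sigma:\mathfrak{g}\to\mathfrak{g}$ be the $\mathbb{C}$-linear function given by $\sigma(d)=d$ and $$\sigma(D_t^+)=\xi_t D_t^-,\qquad \sigma(D_t^-)=\xi_t^{-1}D_t^+\qquad (t\in\mathbb{T}),$$ where $\xi_t$ is the number of graph automorphisms of the rooted tree $t$. Then $\sigma$ is an anti-involution of $\mathfrak{g}$.
   Context: A rooted tree is a finite connected undirected cycle-free graph $t$ with a distinguished vertex $\mathrm{rt}(t)$, its root. Rooted trees are considered up to (root-preserving graph) isomorphism; equality of rooted trees means isomorphism, and $\mathbb{T}$ is the set of all isomorphism classes of rooted trees. $V(t)$ and $E(t)$ are the sets of vertices and edges of $t$, and $|t|$ is the cardinality of $V(t)$. For $e\in E(t)$, removing $e$ divides $t$ into two rooted subtrees: $R_e(t)$ is the one containing $\mathrm{rt}(t)$, and $P_e(t)$ is the other one; a subtree is rooted at its vertex at minimal distance in $t$ from $\mathrm{rt}(t)$. For $s,t\in\mathbb{T}$ and $v\in V(s)$, $s\cup_v t$ is the rooted tree obtained by joining the root of $t$ to $s$ at $v$ by a single new edge, with root $\mathrm{rt}(s)$. For $t_1,t_2,t_3\in\mathbb{T}$ put $$\alpha(t_1,t_2,t_3)=|\{e\in E(t_2)\mid R_e(t_2)=t_3,\ P_e(t_2)=t_1\}|,\qquad \beta(t_1,t_2,t_3)=|\{v\in V(t_3)\mid t_1=t_3\cup_v t_2\}|.$$ The insertion-elimination algebra $\mathfrak{g}$ is the Lie algebra over $\mathbb{C}$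 with basis $\{d\}\cup\{D_t^{+},D_t^-\mid t\in\mathbb{T}\}$ and relations, for $s,t\in\mathbb{T}$: $[D_s^+,D_t^+]=\sum_{r\in\mathbb{T}}(\beta(r,s,t)-\beta(r,t,s))D_r^+$; $[D_s^-,D_t^-]=\sum_{r\in\mathbb{T}}(\alpha(t,r,s)-\alpha(s,r,t))D_r^-$; $[D_s^-,D_t^+]=\sum_{r\in\mathbb{T}}\alpha(s,t,r)D_r^++\sum_{r\in\mathbb{T}}\beta(s,t,r)D_r^-$ for $s\neq t$; $[D_t^-,D_t^+]=d$; $[d,D_t^-]=-|t|D_t^-$; $[d,D_t^+]=|t|D_t^+$. A graph automorphism of a rooted tree $t$ is a bijection $V(t)\to V(t)$ fixing the root and preserving both adjacency and non-adjacency. An anti-involution of a Lie algebra is a linear map $\sigma$ with $\sigma([x,y])=[\sigma(y),\sigma(x)]$ for all $x,y$ and $\sigma^2=\mathrm{id}$. *)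

theory Defs
  imports Complex_Main "HOL-Library.Poly_Mapping" "HOL-Combinatorics.Permutations"
begin

section \<open>Rooted trees as graphs\<close>

text \<open>The edges of a graph are the two-element sets of adjacent vertices.\<close>

record 'a rgraph =
  verts :: "'a set"
  edges :: "'a set set"
  rt :: 'a

definition adj :: "'a set set \<Rightarrow> ('a \<times> 'a) set" where
  "adj E = {(u, v). {u, v} \<in> E}"

definition is_cycle :: "'a set set \<Rightarrow> 'a list \<Rightarrow> bool" where
  "is_cycle E vs \<longleftrightarrow> 3 \<le> length vs \<and> distinct vs \<and>
     (\<forall>i < length vs. {vs ! i, vs ! (Suc i mod length vs)} \<in> E)"

definition rooted_tree :: "'a rgraph \<Rightarrow> bool" where
  "rooted_tree t \<longleftrightarrow>
     finite (verts t) \<and> rt t \<in> verts t \<and>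
     (\<forall>e \<in> edges t. e \<subseteq> verts t \<and> card e = 2) \<and>
     (\<forall>u \<in> verts t. \<forall>v \<in> verts t. (u, v) \<in> (adj (edges t))\<^sup>*) \<and>
     (\<nexists>vs. is_cycle (edges t) vs)"

definition is_iso :: "('a \<Rightarrow> 'b) \<Rightarrow> 'a rgraph \<Rightarrow> 'b rgraph \<Rightarrow> bool" where
  "is_iso f s t \<longleftrightarrow> bij_betw f (verts s) (verts t) \<and> f (rt s) = rt t \<and>
     (\<forall>u \<in> verts s. \<forall>v \<in> verts s. {u, v} \<in> edges s \<longleftrightarrow> {f u, f v} \<in> edges t)"

definition iso :: "'a rgraph \<Rightarrow> 'b rgraph \<Rightarrow> bool" (infix \<open>\<simeq>\<close> 50) where
  "s \<simeq> t \<longleftrightarrow> (\<exists>f. is_iso f s t)"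

definition gdist :: "'a rgraph \<Rightarrow> 'a \<Rightarrow> 'a \<Rightarrow> nat" where
  "gdist t u v = (LEAST n. (u, v) \<in> adj (edges t) ^^ n)"

definition rooted_subtree :: "'a rgraph \<Rightarrow> 'a set \<Rightarrow> 'a rgraph" where
  "rooted_subtree t W = \<lparr>verts = W, edges = {e \<in> edges t. e \<subseteq> W},
     rt = arg_min_on (gdist t (rt t)) W\<rparr>"

definition root_side :: "'a set \<Rightarrow> 'a rgraph \<Rightarrow> 'a set" where
  "root_side e t = {v \<in> verts t. (rt t, v) \<in> (adj (edges t - {e}))\<^sup>*}"

definition R_part :: "'a set \<Rightarrow> 'a rgraph \<Rightarrow> 'a rgraph" where
  "R_part e t = rooted_subtree t (root_side e t)"

definition P_part :: "'a set \<Rightarrow> 'a rgraph \<Rightarrow> 'a rgraph" where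
  "P_part e t = rooted_subtree t (verts t - root_side e t)"

text \<open>\<open>graft s v t\<close> is $s \cup_v t$; the disjoint copies of the vertex sets are tagged by
  \<open>Inl\<close> and \<open>Inr\<close>.\<close>

definition graft :: "'a rgraph \<Rightarrow> 'a \<Rightarrow> 'b rgraph \<Rightarrow> ('a + 'b) rgraph" where
  "graft s v t = \<lparr>verts = Inl ` verts s \<union> Inr ` verts t,
     edges = insert {Inl v, Inr (rt t)} ((`) Inl ` edges s \<union> (`) Inr ` edges t),
     rt = Inl (rt s)\<rparr>"

definition automorphisms :: "'a rgraph \<Rightarrow> ('a \<Rightarrow> 'a) set" where
  "automorphisms t = {f. f permutes verts t \<and> is_iso f t t}"


subsection \<open>Invariance under isomorphism\<close>

lemma is_iso_id: "is_iso id t t"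
  by (simp add: is_iso_def)

lemma is_iso_comp: "is_iso f s t \<Longrightarrow> is_iso g t u \<Longrightarrow> is_iso (g \<circ> f) s u"
proof -
  assume f: "is_iso f s t" and g: "is_iso g t u"
  then have "f x \<in> verts t" if "x \<in> verts s" for x
    using that by (meson is_iso_def bij_betwE)
  then show ?thesis using f g bij_betw_trans[of f "verts s" "verts t" g "verts u"]
    by (simp add: is_iso_def)
qed

lemma is_iso_inv:
  assumes "is_iso f s t" "rt s \<in> verts s"
  shows "is_iso (inv_into (verts s) f) t s"
proof -
  let ?g = "inv_into (verts s) f"
  have b: "bij_betw f (verts s) (verts t)" using assms by (simp add: is_iso_def)
  have g: "bij_betw ?g (verts t) (verts s)" using b by (rule bij_betw_inv_into)
  have fg: "f (?g y) = y" if "y \<in> verts t" for y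
    using b that by (simp add: bij_betw_inv_into_right)
  have gv: "?g y \<in> verts s" if "y \<in> verts t" for y using g that by (auto dest: bij_betwE)
  have "?g (rt t) = rt s" 
    using assms b by (metis bij_betw_inv_into_left is_iso_def)
  moreover have "{u, v} \<in> edges t \<longleftrightarrow> {?g u, ?g v} \<in> edges s"
    if "u \<in> verts t" "v \<in> verts t" for u v
    using assms(1) gv[OF that(1)] gv[OF that(2)] fg[OF that(1)] fg[OF that(2)]
    by (metis is_iso_def)
  ultimately show ?thesis using g by (simp add: is_iso_def)
qed

lemma iso_refl: "t \<simeq> t"
  using is_iso_id by (auto simp: iso_def)

lemma iso_trans: "s \<simeq> t \<Longrightarrow> t \<simeq> u \<Longrightarrow> s \<simeq> u"
  unfolding iso_def by (blast intro: is_iso_comp)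

lemma iso_sym: "rt s \<in> verts s \<Longrightarrow> s \<simeq> t \<Longrightarrow> t \<simeq> s"
  using is_iso_inv by (auto simp: iso_def)

lemma rooted_treeD:
  assumes "rooted_tree t"
  shows "finite (verts t)" "rt t \<in> verts t" "\<And>e. e \<in> edges t \<Longrightarrow> e \<subseteq> verts t"
    "\<And>e. e \<in> edges t \<Longrightarrow> \<exists>u v. e = {u, v} \<and> u \<noteq> v"
    "\<And>u v. u \<in> verts t \<Longrightarrow> v \<in> verts t \<Longrightarrow> (u, v) \<in> (adj (edges t))\<^sup>*"
  using assms by (auto simp: rooted_tree_def card_2_iff)

lemma iso_image_edge:
  assumes "rooted_tree s" "rooted_tree t" "is_iso f s t"
  shows "e \<in> edges s \<Longrightarrow> f ` e \<in> edges t"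
proof -
  assume e: "e \<in> edges s"
  obtain u v where uv: "e = {u, v}" using rooted_treeD(4)[OF assms(1) e] by auto
  then have "u \<in> verts s" "v \<in> verts s" using rooted_treeD(3)[OF assms(1) e] by auto
  then show ?thesis using e assms(3) uv by (auto simp: is_iso_def)
qed

lemma iso_image_edges:
  assumes "rooted_tree s" "rooted_tree t" "is_iso f s t"
  shows "edges t = (`) f ` edges s"
proof
  show "(`) f ` edges s \<subseteq> edges t" using iso_image_edge[OF assms] by auto
  show "edges t \<subseteq> (`) f ` edges s"
  proof
    fix e assume e: "e \<in> edges t"
    let ?g = "inv_into (verts s) f"
    have "is_iso ?g t s" using assms by (simp add: is_iso_inv rooted_treeD)
    then have g: "?g ` e \<in> edges s" using iso_image_edge[OF assms(2,1)] e by blast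
    have "e \<subseteq> f ` verts s" using rooted_treeD(3)[OF assms(2) e] assms(3)
      by (auto simp: is_iso_def bij_betw_def)
    then have "f ` (?g ` e) = e" by (simp add: image_inv_into_cancel)
    then show "e \<in> (`) f ` edges s" using g by (metis imageI)
  qed
qed

lemma iso_bij_edges:
  assumes "rooted_tree s" "rooted_tree t" "is_iso f s t"
  shows "bij_betw ((`) f) (edges s) (edges t)"
proof -
  have "inj_on f (verts s)" using assms(3) by (simp add: is_iso_def bij_betw_def)
  then have "inj_on ((`) f) (edges s)"
    using rooted_treeD(3)[OF assms(1)] by (meson inj_onI inj_on_image_eq_iff)
  then show ?thesis using iso_image_edges[OF assms] by (simp add: bij_betw_def)
qed

lemma iso_mapped_rtrancl:
  assumes "rooted_tree s" "rooted_tree t" "is_iso f s t" "e \<in> edges s"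
    and "(rt s, v) \<in> (adj (edges s - {e}))\<^sup>*"
  shows "(rt t, f v) \<in> (adj (edges t - {f ` e}))\<^sup>*"
  using assms(5)
proof (induction rule: rtrancl_induct)
  case base
  then show ?case using assms(3) by (simp add: is_iso_def)
next
  case (step y z)
  have yz: "{y, z} \<in> edges s" "{y, z} \<noteq> e" using step.hyps by (auto simp: adj_def)
  have "f ` {y, z} \<in> edges t" using iso_image_edge[OF assms(1-3) yz(1)] .
  moreover have "f ` {y, z} \<noteq> f ` e"
    using iso_bij_edges[OF assms(1-3)] yz assms(4) by (metis bij_betw_imp_inj_on inj_onD)
  ultimately have "(f y, f z) \<in> adj (edges t - {f ` e})" by (auto simp: adj_def)
  then show ?case using step.IH by (rule rtrancl_into_rtrancl[rotated])
qed

lemma iso_mapped_relpow: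
  assumes "rooted_tree s" "rooted_tree t" "is_iso f s t"
  shows "(rt s, v) \<in> adj (edges s) ^^ n \<Longrightarrow> (rt t, f v) \<in> adj (edges t) ^^ n"
proof (induction n arbitrary: v)
  case 0
  then show ?case using assms(3) by (simp add: is_iso_def)
next
  case (Suc n)
  obtain y where y: "(rt s, y) \<in> adj (edges s) ^^ n" "(y, v) \<in> adj (edges s)"
    using Suc.prems by auto
  then have "f ` {y, v} \<in> edges t"
    using iso_image_edge[OF assms] by (simp only: adj_def mem_Collect_eq prod.case)
  then have "(f y, f v) \<in> adj (edges t)" by (simp add: adj_def)
  then show ?case using Suc.IH[OF y(1)] by auto
qed

lemma iso_gdist:
  assumes "rooted_tree s" "rooted_tree t" "is_iso f s t" "v \<in> verts s"
  shows "gdist t (rt t) (f v) = gdist s (rt s) v"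
proof -
  let ?g = "inv_into (verts s) f"
  have g: "is_iso ?g t s" using assms by (simp add: is_iso_inv rooted_treeD)
  have "?g (f v) = v" using assms(3,4) by (simp add: is_iso_def bij_betw_def)
  then have "(rt t, f v) \<in> adj (edges t) ^^ n \<longleftrightarrow> (rt s, v) \<in> adj (edges s) ^^ n" for n
    using iso_mapped_relpow[OF assms(1-3)] iso_mapped_relpow[OF assms(2,1) g] by metis
  then show ?thesis by (simp add: gdist_def)
qed

lemma iso_root_side:
  assumes "rooted_tree s" "rooted_tree t" "is_iso f s t" "e \<in> edges s"
  shows "root_side (f ` e) t = f ` root_side e s"
proof -
  let ?g = "inv_into (verts s) f"
  have inj: "inj_on f (verts s)" and im: "f ` verts s = verts t"
    using assms(3) by (auto simp: is_iso_def bij_betw_def)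
  have g: "is_iso ?g t s" using assms by (simp add: is_iso_inv rooted_treeD)
  have fe: "f ` e \<in> edges t" using iso_image_edge[OF assms(1-3)] assms(4) .
  have ge: "?g ` f ` e = e"
    using inj rooted_treeD(3)[OF assms(1,4)] by (simp add: inv_into_image_cancel)
  have "(rt t, f v) \<in> (adj (edges t - {f ` e}))\<^sup>* \<longleftrightarrow> (rt s, v) \<in> (adj (edges s - {e}))\<^sup>*"
    if "v \<in> verts s" for v
    using iso_mapped_rtrancl[OF assms] iso_mapped_rtrancl[OF assms(2,1) g fe] ge that inj
    by (metis inv_into_f_f)
  then have "{w \<in> f ` verts s. (rt t, w) \<in> (adj (edges t - {f ` e}))\<^sup>*} =
      f ` {v \<in> verts s. (rt s, v) \<in> (adj (edges s - {e}))\<^sup>*}"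
    by blast
  then show ?thesis using im by (simp add: root_side_def)
qed

text \<open>The minimum defining the root of either part is attained only once, so the choice made by
  \<open>arg_min_on\<close> is immaterial.\<close>

lemma walk_crosses:
  assumes "rooted_tree t" "(rt t, y) \<in> adj (edges t) ^^ n" "y \<notin> root_side e t"
  shows "\<exists>k w. k \<le> n \<and> w \<in> e \<and> w \<in> verts t - root_side e t \<and> e - {w} \<subseteq> root_side e t \<and>
    (rt t, w) \<in> adj (edges t) ^^ k \<and> (k = n \<longrightarrow> w = y)"
  using assms(2,3)
proof (induction n arbitrary: y)
  case 0
  then show ?case using rooted_treeD(2)[OF assms(1)] by (simp add: root_side_def)
next
  case (Suc n)
  obtain x where x: "(rt t, x) \<in> adj (edges t) ^^ n" "{x, y} \<in> edges t"
    using Suc.prems(1) by (auto simp: adj_def)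
  have yv: "y \<in> verts t" using rooted_treeD(3)[OF assms(1) x(2)] by auto
  show ?case
  proof (cases "x \<in> root_side e t")
    case True
    have "{x, y} = e"
    proof (rule ccontr)
      assume "{x, y} \<noteq> e"
      then have "(x, y) \<in> adj (edges t - {e})" using x by (auto simp: adj_def)
      then have "y \<in> root_side e t" using True yv
        by (auto simp: root_side_def intro: rtrancl_into_rtrancl)
      then show False using Suc.prems by simp
    qed
    then show ?thesis using Suc.prems True yv by (intro exI[of _ "Suc n"] exI[of _ y]) auto
  next
    case False
    then obtain k w where "k \<le> n" "w \<in> e \<and> w \<in> verts t - root_side e t \<and>
        e - {w} \<subseteq> root_side e t \<and> (rt t, w) \<in> adj (edges t) ^^ k"
      using Suc.IH[OF x(1)] by blast
    then show ?thesis by (intro exI[of _ k] exI[of _ w]) simp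
  qed
qed

lemma gdist_walk:
  assumes "rooted_tree t" "y \<in> verts t"
  shows "(rt t, y) \<in> adj (edges t) ^^ gdist t (rt t) y"
proof -
  have "\<exists>n. (rt t, y) \<in> adj (edges t) ^^ n"
    using rooted_treeD(5)[OF assms(1) rooted_treeD(2)[OF assms(1)] assms(2)]
    by (simp add: rtrancl_is_UN_relpow)
  then show ?thesis unfolding gdist_def by (rule LeastI_ex)
qed

lemma unique_min_P:
  assumes "rooted_tree t" "W = verts t - root_side e t" "W \<noteq> {}"
  shows "\<exists>w \<in> W. \<forall>y \<in> W. y \<noteq> w \<longrightarrow> gdist t (rt t) w < gdist t (rt t) y"
proof -
  have cross: "\<exists>w \<in> W. w \<in> e \<and> e - {w} \<subseteq> root_side e t \<and>
      (y \<noteq> w \<longrightarrow> gdist t (rt t) w < gdist t (rt t) y)" if y: "y \<in> W" for y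
  proof -
    obtain k w where w: "k \<le> gdist t (rt t) y" "w \<in> e" "w \<in> W" "e - {w} \<subseteq> root_side e t"
      "(rt t, w) \<in> adj (edges t) ^^ k" "k = gdist t (rt t) y \<longrightarrow> w = y"
      using walk_crosses[OF assms(1) gdist_walk[OF assms(1)], of y e] y assms(2) by auto
    have "gdist t (rt t) w \<le> k" unfolding gdist_def using w(5) by (rule Least_le)
    then show ?thesis using w by (intro bexI[of _ w]) auto
  qed
  from assms(3) obtain y0 where "y0 \<in> W" by auto
  from cross[OF this] obtain w where w: "w \<in> W" "w \<in> e" "e - {w} \<subseteq> root_side e t" by auto
  have "gdist t (rt t) w < gdist t (rt t) y" if "y \<in> W" "y \<noteq> w" for y
  proof -
    obtain w' where "w' \<in> W" "w' \<in> e" "y \<noteq> w' \<longrightarrow> gdist t (rt t) w' < gdist t (rt t) y"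
      using cross[OF \<open>y \<in> W\<close>] by auto
    moreover have "w' = w" using calculation w assms(2) by auto
    ultimately show ?thesis using that by simp
  qed
  then show ?thesis using w(1) by blast
qed

lemma unique_min_R:
  assumes "rooted_tree t" "W = root_side e t"
  shows "\<exists>w \<in> W. \<forall>y \<in> W. y \<noteq> w \<longrightarrow> gdist t (rt t) w < gdist t (rt t) y"
proof (intro bexI[of _ "rt t"] ballI impI)
  show "rt t \<in> W" using assms rooted_treeD(2) by (auto simp: root_side_def)
  fix y assume y: "y \<in> W" "y \<noteq> rt t"
  have "gdist t (rt t) (rt t) = 0" unfolding gdist_def by (rule Least_eq_0) simp
  moreover have "gdist t (rt t) y \<noteq> 0"
    using gdist_walk[OF assms(1), of y] y assms(2) by (auto simp: root_side_def intro: gr0I)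
  ultimately show "gdist t (rt t) (rt t) < gdist t (rt t) y" by simp
qed

lemma arg_min_on_unique:
  fixes h :: "'a \<Rightarrow> nat"
  assumes "w \<in> W" "\<forall>y \<in> W. y \<noteq> w \<longrightarrow> h w < h y"
  shows "arg_min_on h W = w"
proof -
  have "is_arg_min h (\<lambda>x. x \<in> W) (arg_min_on h W)"
    unfolding arg_min_on_def using assms
    by (metis arg_min_natI is_arg_min_linorder arg_min_nat_le)
  then show ?thesis using assms by (auto simp: is_arg_min_def)
qed

lemma arg_min_on_mem:
  fixes h :: "'a \<Rightarrow> nat"
  assumes "\<exists>w \<in> W. \<forall>y \<in> W. y \<noteq> w \<longrightarrow> h w < h y"
  shows "arg_min_on h W \<in> W"
proof -
  obtain w where w: "w \<in> W" "\<forall>y \<in> W. y \<noteq> w \<longrightarrow> h w < h y" using assms by blast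
  show ?thesis using arg_min_on_unique[OF w] w(1) by simp
qed

lemma rooted_subtree_iso:
  assumes "rooted_tree s" "rooted_tree t" "is_iso f s t" "W \<subseteq> verts s"
    and "\<exists>w \<in> W. \<forall>y \<in> W. y \<noteq> w \<longrightarrow> gdist s (rt s) w < gdist s (rt s) y"
  shows "is_iso f (rooted_subtree s W) (rooted_subtree t (f ` W))"
proof -
  have inj: "inj_on f (verts s)" using assms(3) by (simp add: is_iso_def bij_betw_def)
  obtain w where w: "w \<in> W" "\<forall>y \<in> W. y \<noteq> w \<longrightarrow> gdist s (rt s) w < gdist s (rt s) y"
    using assms(5) by auto
  have d: "gdist t (rt t) (f y) = gdist s (rt s) y" if "y \<in> W" for y
    using iso_gdist[OF assms(1-3)] that assms(4) by auto
  have "arg_min_on (gdist s (rt s)) W = w" by (rule arg_min_on_unique[OF w])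
  moreover have "arg_min_on (gdist t (rt t)) (f ` W) = f w"
    by (rule arg_min_on_unique) (use w d in auto)
  moreover have "bij_betw f W (f ` W)"
    using inj assms(4) by (metis bij_betw_imageI inj_on_subset)
  moreover have "{u, v} \<in> edges s \<longleftrightarrow> {f u, f v} \<in> edges t" if "u \<in> W" "v \<in> W" for u v
    using assms(3,4) that unfolding is_iso_def by blast
  ultimately show ?thesis by (auto simp: is_iso_def rooted_subtree_def)
qed

lemma R_part_iso:
  assumes "rooted_tree s" "rooted_tree t" "is_iso f s t" "e \<in> edges s"
  shows "is_iso f (R_part e s) (R_part (f ` e) t)"
  unfolding R_part_def iso_root_side[OF assms]
  by (rule rooted_subtree_iso[OF assms(1-3)])
    (use unique_min_R[OF assms(1) refl] in \<open>auto simp: root_side_def\<close>)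

lemma P_part_iso:
  assumes "rooted_tree s" "rooted_tree t" "is_iso f s t" "e \<in> edges s"
    "verts s - root_side e s \<noteq> {}"
  shows "is_iso f (P_part e s) (P_part (f ` e) t)"
proof -
  have "verts t - f ` root_side e s = f ` (verts s - root_side e s)"
    using assms(3) inj_on_image_set_diff[of f "verts s" "verts s" "root_side e s"]
    by (auto simp: is_iso_def bij_betw_def root_side_def)
  then show ?thesis unfolding P_part_def iso_root_side[OF assms(1-4)]
    using rooted_subtree_iso[OF assms(1-3) _ unique_min_P[OF assms(1) refl assms(5)]] by simp
qed

lemma alpha_invariant:
  fixes t1 t2 t3 t1' t2' t3' :: "'a rgraph"
  assumes t: "rooted_tree t1" "rooted_tree t2" "rooted_tree t3"
      "rooted_tree t1'" "rooted_tree t2'" "rooted_tree t3'"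
    and i: "t1 \<simeq> t1'" "t2 \<simeq> t2'" "t3 \<simeq> t3'"
  shows "card {e \<in> edges t2. R_part e t2 \<simeq> t3 \<and> P_part e t2 \<simeq> t1} =
    card {e \<in> edges t2'. R_part e t2' \<simeq> t3' \<and> P_part e t2' \<simeq> t1'}"
proof -
  have le: "card {e \<in> edges s2. R_part e s2 \<simeq> s3 \<and> P_part e s2 \<simeq> s1} \<le>
    card {e \<in> edges s2'. R_part e s2' \<simeq> s3' \<and> P_part e s2' \<simeq> s1'}"
    if s: "rooted_tree s1" "rooted_tree s2" "rooted_tree s2'"
      and i: "s1 \<simeq> s1'" "s2 \<simeq> s2'" "s3 \<simeq> s3'"
    for s1 s2 s3 :: "'a rgraph" and s1' s2' s3' :: "'a rgraph"
  proof -
    obtain f where f: "is_iso f s2 s2'" using i(2) by (auto simp: iso_def)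
    let ?A = "{e \<in> edges s2. R_part e s2 \<simeq> s3 \<and> P_part e s2 \<simeq> s1}"
    let ?B = "{e \<in> edges s2'. R_part e s2' \<simeq> s3' \<and> P_part e s2' \<simeq> s1'}"
    have "edges s2' \<subseteq> Pow (verts s2')" using rooted_treeD(3)[OF s(3)] by auto
    then have "finite (edges s2')"
      using rooted_treeD(1)[OF s(3)] by (simp add: finite_subset)
    then have fin: "finite ?B" by simp
    have inj: "inj_on ((`) f) ?A"
      by (rule inj_on_subset[OF bij_betw_imp_inj_on[OF iso_bij_edges[OF s(2,3) f]]]) auto
    have "(`) f ` ?A \<subseteq> ?B"
    proof (intro image_subsetI, clarify)
      fix e assume e: "e \<in> edges s2" "R_part e s2 \<simeq> s3" "P_part e s2 \<simeq> s1"
      have Rr: "rt (R_part e s2) \<in> verts (R_part e s2)"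
        using arg_min_on_mem[OF unique_min_R[OF s(2) refl, of e]]
        by (simp add: R_part_def rooted_subtree_def)
      have ne: "verts s2 - root_side e s2 \<noteq> {}"
      proof
        assume "verts s2 - root_side e s2 = {}"
        then have "verts s1 = {}" using e(3)
          by (auto simp: iso_def is_iso_def P_part_def rooted_subtree_def bij_betw_def)
        then show False using rooted_treeD(2)[OF s(1)] by simp
      qed
      have Pr: "rt (P_part e s2) \<in> verts (P_part e s2)"
        using arg_min_on_mem[OF unique_min_P[OF s(2) refl ne]]
        by (simp add: P_part_def rooted_subtree_def)
      have "R_part (f ` e) s2' \<simeq> R_part e s2"
        using R_part_iso[OF s(2,3) f e(1)] iso_sym[OF Rr] by (auto simp: iso_def)
      moreover have "P_part (f ` e) s2' \<simeq> P_part e s2"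
        using P_part_iso[OF s(2,3) f e(1) ne] iso_sym[OF Pr] by (auto simp: iso_def)
      ultimately show "f ` e \<in> edges s2' \<and> R_part (f ` e) s2' \<simeq> s3' \<and> P_part (f ` e) s2' \<simeq> s1'"
        using e i iso_image_edge[OF s(2,3) f] by (meson iso_trans)
    qed
    with inj show ?thesis using fin by (rule card_inj_on_le)
  qed
  have "t1' \<simeq> t1" "t2' \<simeq> t2" "t3' \<simeq> t3" using t i by (simp_all add: iso_sym rooted_treeD)
  then show ?thesis
    using le[OF t(1,2,5) i] le[OF t(4,5,2)] by (simp add: le_antisym)
qed

lemma graft_edge_iff:
  "{Inl a, Inl b} \<in> edges (graft s v t) \<longleftrightarrow> {a, b} \<in> edges s"
  "{Inr c, Inr d} \<in> edges (graft s v t) \<longleftrightarrow> {c, d} \<in> edges t"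
  "rooted_tree s \<Longrightarrow> rooted_tree t \<Longrightarrow>
    {Inl a, Inr d} \<in> edges (graft s v t) \<longleftrightarrow> a = v \<and> d = rt t"
proof -
  have l: "{Inl a, Inl b} = Inl ` e \<longleftrightarrow> e = {a, b}" for e :: "'a set"
    and a b :: 'a using inj_image_eq_iff[of Inl e "{a, b}"] by auto
  have r: "{Inr a, Inr b} = Inr ` e \<longleftrightarrow> e = {a, b}" for e :: "'b set"
    and a b :: 'b using inj_image_eq_iff[of Inr e "{a, b}"] by auto
  show "{Inl a, Inl b} \<in> edges (graft s v t) \<longleftrightarrow> {a, b} \<in> edges s"
    by (auto simp: graft_def doubleton_eq_iff image_iff l)
  show "{Inr c, Inr d} \<in> edges (graft s v t) \<longleftrightarrow> {c, d} \<in> edges t"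
    by (auto simp: graft_def doubleton_eq_iff image_iff r)
  show "{Inl a, Inr d} \<in> edges (graft s v t) \<longleftrightarrow> a = v \<and> d = rt t"
    by (auto simp: graft_def doubleton_eq_iff)
qed

lemma graft_iso:
  assumes s: "rooted_tree s" "rooted_tree s'" and t: "rooted_tree t" "rooted_tree t'"
    and f: "is_iso f s s'" and g: "is_iso g t t'" and v: "v \<in> verts s"
  shows "is_iso (map_sum f g) (graft s v t) (graft s' (f v) t')"
proof -
  have f': "bij_betw f (verts s) (verts s')" "f (rt s) = rt s'"
    "\<And>a b. a \<in> verts s \<Longrightarrow> b \<in> verts s \<Longrightarrow> {a, b} \<in> edges s \<longleftrightarrow> {f a, f b} \<in> edges s'"
    using f by (auto simp: is_iso_def)
  have g': "bij_betw g (verts t) (verts t')" "g (rt t) = rt t'"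
    "\<And>a b. a \<in> verts t \<Longrightarrow> b \<in> verts t \<Longrightarrow> {a, b} \<in> edges t \<longleftrightarrow> {g a, g b} \<in> edges t'"
    using g by (auto simp: is_iso_def)
  have V: "verts (graft s v t) = Inl ` verts s \<union> Inr ` verts t"
    "verts (graft s' (f v) t') = Inl ` verts s' \<union> Inr ` verts t'"
    by (auto simp: graft_def)
  have bij: "bij_betw (map_sum f g) (verts (graft s v t)) (verts (graft s' (f v) t'))"
    unfolding bij_betw_def
  proof
    show "inj_on (map_sum f g) (verts (graft s v t))"
      using bij_betw_imp_inj_on[OF f'(1)] bij_betw_imp_inj_on[OF g'(1)]
      unfolding V by (intro inj_onI) (elim UnE imageE; simp add: inj_on_eq_iff)
    have "f ` verts s = verts s'" "g ` verts t = verts t'"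
      using f'(1) g'(1) by (simp_all add: bij_betw_def)
    moreover have "map_sum f g ` (Inl ` verts s \<union> Inr ` verts t) =
        Inl ` (f ` verts s) \<union> Inr ` (g ` verts t)"
      by (simp add: image_Un image_image)
    ultimately show "map_sum f g ` verts (graft s v t) = verts (graft s' (f v) t')"
      unfolding V by simp
  qed
  have mixed: "{Inl a, Inr d} \<in> edges (graft s v t) \<longleftrightarrow>
      {Inl (f a), Inr (g d)} \<in> edges (graft s' (f v) t')"
    if "a \<in> verts s" "d \<in> verts t" for a d
  proof -
    have "f a = f v \<longleftrightarrow> a = v"
      using inj_on_eq_iff[OF bij_betw_imp_inj_on[OF f'(1)] that(1) v] .
    moreover have "g d = rt t' \<longleftrightarrow> d = rt t"
      using inj_on_eq_iff[OF bij_betw_imp_inj_on[OF g'(1)] that(2) rooted_treeD(2)[OF t(1)]] g'(2)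
      by simp
    ultimately show ?thesis
      by (simp add: graft_edge_iff(3)[OF s(1) t(1)] graft_edge_iff(3)[OF s(2) t(2)])
  qed
  have "{x, y} \<in> edges (graft s v t) \<longleftrightarrow>
      {map_sum f g x, map_sum f g y} \<in> edges (graft s' (f v) t')"
    if "x \<in> verts (graft s v t)" "y \<in> verts (graft s v t)" for x y
  proof (cases x; cases y)
    fix a b assume "x = Inl a" "y = Inl b"
    then show ?thesis using that f'(3)[of a b] by (auto simp: V graft_edge_iff(1))
  next
    fix a b assume "x = Inl a" "y = Inr b"
    then show ?thesis using that mixed[of a b] by (auto simp: V)
  next
    fix a b assume "x = Inr a" "y = Inl b"
    then show ?thesis using that mixed[of b a] by (auto simp: V insert_commute)
  next
    fix a b assume "x = Inr a" "y = Inr b"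
    then show ?thesis using that g'(3)[of a b] by (auto simp: V graft_edge_iff(2))
  qed
  then show ?thesis using bij f'(2) by (simp add: is_iso_def) (simp add: graft_def)
qed

lemma beta_invariant:
  fixes t1 t2 t3 t1' t2' t3' :: "'a rgraph"
  assumes t: "rooted_tree t1" "rooted_tree t2" "rooted_tree t3"
      "rooted_tree t1'" "rooted_tree t2'" "rooted_tree t3'"
    and i: "t1 \<simeq> t1'" "t2 \<simeq> t2'" "t3 \<simeq> t3'"
  shows "card {v \<in> verts t3. t1 \<simeq> graft t3 v t2} = card {v \<in> verts t3'. t1' \<simeq> graft t3' v t2'}"
proof -
  have le: "card {v \<in> verts s3. s1 \<simeq> graft s3 v s2} \<le> card {v \<in> verts s3'. s1' \<simeq> graft s3' v s2'}"
    if s: "rooted_tree s1" "rooted_tree s2" "rooted_tree s3" "rooted_tree s2'" "rooted_tree s3'"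
      and i: "s1 \<simeq> s1'" "s2 \<simeq> s2'" "s3 \<simeq> s3'"
    for s1 s2 s3 :: "'a rgraph" and s1' s2' s3' :: "'a rgraph"
  proof -
    obtain f g where f: "is_iso f s3 s3'" and g: "is_iso g s2 s2'"
      using i by (auto simp: iso_def)
    have b: "bij_betw f (verts s3) (verts s3')" using f by (simp add: is_iso_def)
    have "s1' \<simeq> s1" using iso_sym[OF rooted_treeD(2)[OF s(1)] i(1)] .
    moreover have "graft s3 v s2 \<simeq> graft s3' (f v) s2'" if "v \<in> verts s3" for v
      using graft_iso[OF s(3,5,2,4) f g that] by (auto simp: iso_def)
    ultimately have "f ` {v \<in> verts s3. s1 \<simeq> graft s3 v s2} \<subseteq>
        {v \<in> verts s3'. s1' \<simeq> graft s3' v s2'}"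
      using bij_betwE[OF b] by (blast intro: iso_trans)
    moreover have "inj_on f {v \<in> verts s3. s1 \<simeq> graft s3 v s2}"
      by (rule inj_on_subset[OF bij_betw_imp_inj_on[OF b]]) auto
    ultimately show ?thesis using rooted_treeD(1)[OF s(5)] by (intro card_inj_on_le) auto
  qed
  have "t1' \<simeq> t1" "t2' \<simeq> t2" "t3' \<simeq> t3" using t i by (simp_all add: iso_sym rooted_treeD)
  then show ?thesis using le[OF t(1-3,5,6) i] le[OF t(4-6,2,3)] by (simp add: le_antisym)
qed

lemma automorphisms_invariant:
  fixes s t :: "'a rgraph"
  assumes t: "rooted_tree s" "rooted_tree t" and i: "s \<simeq> t"
  shows "card (automorphisms s) = card (automorphisms t)"
proof -
  have le: "card (automorphisms s) \<le> card (automorphisms t)"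
    if t: "rooted_tree s" "rooted_tree t" and i: "s \<simeq> t" for s t :: "'a rgraph"
  proof -
    obtain f where f: "is_iso f s t" using i by (auto simp: iso_def)
    let ?g = "inv_into (verts s) f"
    have g: "is_iso ?g t s" using f t by (simp add: is_iso_inv rooted_treeD)
    have b: "bij_betw f (verts s) (verts t)" using f by (simp add: is_iso_def)
    let ?c = "\<lambda>h y. if y \<in> verts t then f (h (?g y)) else y"
    have cc: "is_iso (?c h) t t" if "is_iso h s s" for h
    proof -
      have "is_iso (f \<circ> (h \<circ> ?g)) t t" using is_iso_comp[OF is_iso_comp[OF g that] f] .
      then show ?thesis using rooted_treeD(2)[OF t(2)]
        unfolding is_iso_def by (simp cong: bij_betw_cong)
    qed
    have "?c ` automorphisms s \<subseteq> automorphisms t"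
    proof (intro image_subsetI)
      fix h assume "h \<in> automorphisms s"
      then have c: "is_iso (?c h) t t" using cc by (simp add: automorphisms_def)
      then have "?c h permutes verts t" by (intro bij_imp_permutes) (simp_all add: is_iso_def)
      then show "?c h \<in> automorphisms t" using c by (simp add: automorphisms_def)
    qed
    moreover have "inj_on ?c (automorphisms s)"
    proof (intro inj_onI ext)
      fix h k x assume h: "h \<in> automorphisms s" and k: "k \<in> automorphisms s" and eq: "?c h = ?c k"
      have p: "h permutes verts s" "k permutes verts s" using h k by (auto simp: automorphisms_def)
      show "h x = k x"
      proof (cases "x \<in> verts s")
        case True
        then have "f x \<in> verts t" "?g (f x) = x" using b by (auto simp: bij_betw_def)
        then have "f (h x) = f (k x)" using fun_cong[OF eq, of "f x"] by simp
        then show ?thesis using b True p by (meson bij_betw_def inj_onD permutes_in_image)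
      next
        case False
        then show ?thesis using p by (simp add: permutes_not_in)
      qed
    qed
    moreover have "finite (automorphisms t)"
      unfolding automorphisms_def using finite_permutations[OF rooted_treeD(1)[OF t(2)]] by simp
    ultimately show ?thesis by (intro card_inj_on_le)
  qed
  show ?thesis using le[OF t i] le[OF t(2,1) iso_sym[OF rooted_treeD(2)[OF t(1)] i]] by simp
qed


section \<open>Isomorphism classes of rooted trees\<close>

text \<open>Every finite graph is isomorphic to one whose vertices are natural numbers, so the
  isomorphism classes of rooted trees on subsets of \<open>nat\<close> form all of $\mathbb{T}$.\<close>

quotient_type tree = "nat rgraph" / partial:
  "\<lambda>s t. rooted_tree s \<and> rooted_tree t \<and> s \<simeq> t"
proof (rule part_equivpI)
  have "rooted_tree \<lparr>verts = {0::nat}, edges = {}, rt = 0\<rparr>"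
    by (auto simp: rooted_tree_def is_cycle_def intro: exI[of _ 0])
  then show "\<exists>t :: nat rgraph. rooted_tree t \<and> rooted_tree t \<and> t \<simeq> t" using iso_refl by blast
  show "symp (\<lambda>s t :: nat rgraph. rooted_tree s \<and> rooted_tree t \<and> s \<simeq> t)"
    by (intro sympI) (simp add: iso_sym rooted_treeD(2))
  show "transp (\<lambda>s t :: nat rgraph. rooted_tree s \<and> rooted_tree t \<and> s \<simeq> t)"
    by (intro transpI) (meson iso_trans)
qed

lift_definition tree_size :: "tree \<Rightarrow> nat" is "\<lambda>t. card (verts t)"
  unfolding iso_def is_iso_def using bij_betw_same_card by blast

lift_definition alpha :: "tree \<Rightarrow> tree \<Rightarrow> tree \<Rightarrow> nat" is
  "\<lambda>t1 t2 t3. card {e \<in> edges t2. R_part e t2 \<simeq> t3 \<and> P_part e t2 \<simeq> t1}"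
  by (rule alpha_invariant) auto

lift_definition beta :: "tree \<Rightarrow> tree \<Rightarrow> tree \<Rightarrow> nat" is
  "\<lambda>t1 t2 t3. card {v \<in> verts t3. t1 \<simeq> graft t3 v t2}"
  by (rule beta_invariant) auto

lift_definition num_aut :: "tree \<Rightarrow> nat" is "\<lambda>t. card (automorphisms t)"
  by (rule automorphisms_invariant) auto


section \<open>The insertion-elimination algebra\<close>

datatype ie_basis = D_elt | D_plus tree | D_minus tree

type_synonym ie_alg = "ie_basis \<Rightarrow>\<^sub>0 complex"

definition cscale :: "complex \<Rightarrow> ('b \<Rightarrow>\<^sub>0 complex) \<Rightarrow> ('b \<Rightarrow>\<^sub>0 complex)" where
  "cscale c x = Poly_Mapping.map ((*) c) x"

abbreviation bas :: "ie_basis \<Rightarrow> ie_alg" where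
  "bas b \<equiv> Poly_Mapping.single b 1"

definition linear_ext :: "('b \<Rightarrow> ('c \<Rightarrow>\<^sub>0 complex)) \<Rightarrow> ('b \<Rightarrow>\<^sub>0 complex) \<Rightarrow> ('c \<Rightarrow>\<^sub>0 complex)" where
  "linear_ext f x = (\<Sum>b \<in> Poly_Mapping.keys x. cscale (Poly_Mapping.lookup x b) (f b))"

text \<open>The brackets of basis elements. Those not listed among the defining relations are forced by
  antisymmetry. In each sum over $\mathbb{T}$ only finitely many summands are nonzero
  (\<open>Sum_any\<close> would be \<open>0\<close> otherwise): a nonzero \<open>alpha\<close> or \<open>beta\<close> fixes the size of \<open>r\<close>,
  and there are finitely many trees of each size.\<close>

definition bracket_pm :: "tree \<Rightarrow> tree \<Rightarrow> ie_alg" where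
  "bracket_pm s t = (if s = t then bas D_elt
     else Sum_any (\<lambda>r. cscale (of_nat (alpha s t r)) (bas (D_plus r)))
        + Sum_any (\<lambda>r. cscale (of_nat (beta s t r)) (bas (D_minus r))))"

fun bracket_basis :: "ie_basis \<Rightarrow> ie_basis \<Rightarrow> ie_alg" where
  "bracket_basis (D_plus s) (D_plus t) =
     Sum_any (\<lambda>r. cscale (of_nat (beta r s t) - of_nat (beta r t s)) (bas (D_plus r)))"
| "bracket_basis (D_minus s) (D_minus t) =
     Sum_any (\<lambda>r. cscale (of_nat (alpha t r s) - of_nat (alpha s r t)) (bas (D_minus r)))"
| "bracket_basis (D_minus s) (D_plus t) = bracket_pm s t"
| "bracket_basis (D_plus t) (D_minus s) = - bracket_pm s t"
| "bracket_basis D_elt (D_minus t) = cscale (- of_nat (tree_size t)) (bas (D_minus t))"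
| "bracket_basis (D_minus t) D_elt = cscale (of_nat (tree_size t)) (bas (D_minus t))"
| "bracket_basis D_elt (D_plus t) = cscale (of_nat (tree_size t)) (bas (D_plus t))"
| "bracket_basis (D_plus t) D_elt = cscale (- of_nat (tree_size t)) (bas (D_plus t))"
| "bracket_basis D_elt D_elt = 0"

definition bracket :: "ie_alg \<Rightarrow> ie_alg \<Rightarrow> ie_alg" where
  "bracket x y = linear_ext (\<lambda>a. linear_ext (\<lambda>b. bracket_basis a b) y) x"

fun sigma_basis :: "ie_basis \<Rightarrow> ie_alg" where
  "sigma_basis D_elt = bas D_elt"
| "sigma_basis (D_plus t) = cscale (of_nat (num_aut t)) (bas (D_minus t))"
| "sigma_basis (D_minus t) = cscale (inverse (of_nat (num_aut t))) (bas (D_plus t))"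

definition sigma :: "ie_alg \<Rightarrow> ie_alg" where
  "sigma = linear_ext sigma_basis"

definition anti_involution ::
    "(complex \<Rightarrow> 'v \<Rightarrow> 'v) \<Rightarrow> ('v \<Rightarrow> 'v \<Rightarrow> 'v) \<Rightarrow> ('v::ab_group_add \<Rightarrow> 'v) \<Rightarrow> bool" where
  "anti_involution scale br f \<longleftrightarrow> Vector_Spaces.linear scale scale f \<and>
     (\<forall>x y. f (br x y) = br (f y) (f x)) \<and> f \<circ> f = id"

end

theory Submission
  imports Defs
begin

text \<open>
  The map \<open>sigma\<close> exchanges the relations of the $D^+$ with those of the $D^-$ because the structure
  constants satisfy, for all trees $r$, $s$, $t$,
  $$\xi_r\,\xi_s\,\alpha(r,t,s) = \xi_t\,\beta(t,r,s),$$
  which is \<open>alpha_beta\<close>. This identity is a double count. Consider the pairs $(v,\varphi)$ of a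
  vertex $v$ of $s$ and an isomorphism $\varphi : s\cup_v r \to t$. For each $v$ with
  $s\cup_v r = t$ there are $\xi_t$ isomorphisms, so there are $\xi_t\,\beta(t,r,s)$ pairs. On the other
  hand $\varphi$ maps the new edge to an edge $e$ of $t$ and restricts to isomorphisms
  $s\to R_e(t)$ and $r\to P_e(t)$. Conversely, an edge $e$ and two such isomorphisms
  glue to one isomorphism defined on $s\cup_v r$, where $v$ is the preimage of the end of $e$ on the
  root side (\<open>graft_iso_bij\<close>). So the number of pairs is also $\xi_r\,\xi_s\,\alpha(r,t,s)$.

  Both sides of $\sigma([x,y]) = [\sigma(y),\sigma(x)]$ are bilinear, so it suffices to compare
  them on basis elements. There the sums over $r$ agree term by term: substituting
  $\alpha(r,t,s) = \xi_t\,\beta(t,r,s) / (\xi_r\,\xi_s)$ turns each relation into its mirror image.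
\<close>


section \<open>Counting isomorphisms of rooted graphs\<close>

text \<open>Isomorphisms are functions on the whole vertex type; to count them, their values outside the
  graph are fixed to be \<open>undefined\<close>.\<close>

definition iso_maps :: "'a rgraph \<Rightarrow> 'b rgraph \<Rightarrow> ('a \<Rightarrow> 'b) set" where
  "iso_maps s t = {f \<in> extensional (verts s). is_iso f s t}"

lemma is_iso_cong:
  assumes "rt s \<in> verts s" "\<And>x. x \<in> verts s \<Longrightarrow> f x = g x"
  shows "is_iso f s t \<longleftrightarrow> is_iso g s t"
  using assms bij_betw_cong[of "verts s" f g "verts t"] by (simp add: is_iso_def)

lemma is_iso_restrict:
  assumes "rt s \<in> verts s" "is_iso f s t"
  shows "restrict f (verts s) \<in> iso_maps s t"
  using assms is_iso_cong[of s f "restrict f (verts s)" t] by (simp add: iso_maps_def)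

lemma iso_maps_empty: "\<not> s \<simeq> t \<Longrightarrow> iso_maps s t = {}"
  by (auto simp: iso_maps_def iso_def)

lemma finite_iso_maps:
  assumes "finite (verts s)"
  shows "finite (iso_maps s t)"
proof (cases "s \<simeq> t")
  case True
  then have "finite (verts t)" using assms by (auto simp: iso_def is_iso_def bij_betw_finite)
  then have "finite (verts s \<rightarrow>\<^sub>E verts t)" using assms by (simp add: finite_PiE)
  moreover have "iso_maps s t \<subseteq> verts s \<rightarrow>\<^sub>E verts t"
    by (auto simp: iso_maps_def is_iso_def PiE_def dest: bij_betwE)
  ultimately show ?thesis by (rule finite_subset[rotated])
qed (simp add: iso_maps_empty)

lemma automorphismI:
  assumes "rt t \<in> verts t" "is_iso f t t"
  shows "(\<lambda>x. if x \<in> verts t then f x else x) \<in> automorphisms t"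
proof -
  have "is_iso (\<lambda>x. if x \<in> verts t then f x else x) t t"
    using assms is_iso_cong[of t f "\<lambda>x. if x \<in> verts t then f x else x" t] by simp
  then show ?thesis
    by (auto simp: automorphisms_def is_iso_def intro: bij_imp_permutes)
qed

text \<open>Composition with one fixed isomorphism turns the automorphisms of either graph into the
  isomorphisms between the two; hence this count and the next one.\<close>

lemma card_iso_maps_source:
  assumes s: "rt s \<in> verts s" and i: "s \<simeq> t"
  shows "card (iso_maps s t) = card (automorphisms s)"
proof -
  obtain f where f: "is_iso f s t" using i by (auto simp: iso_def)
  let ?g = "inv_into (verts s) f"
  have b: "bij_betw f (verts s) (verts t)" using f by (simp add: is_iso_def)
  have g: "is_iso ?g t s" using f s by (rule is_iso_inv)
  let ?c = "\<lambda>h. restrict (f \<circ> h) (verts s)"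
  have "bij_betw ?c (automorphisms s) (iso_maps s t)"
  proof (intro bij_betw_imageI inj_onI subset_antisym subsetI)
    fix h k assume h: "h \<in> automorphisms s" and k: "k \<in> automorphisms s" and eq: "?c h = ?c k"
    have p: "h permutes verts s" "k permutes verts s" using h k by (auto simp: automorphisms_def)
    show "h = k"
    proof
      fix x show "h x = k x"
      proof (cases "x \<in> verts s")
        case True
        then have "f (h x) = f (k x)" using fun_cong[OF eq, of x] by simp
        then show ?thesis using b True p by (meson bij_betw_def inj_onD permutes_in_image)
      next
        case False
        then show ?thesis using p by (simp add: permutes_not_in)
      qed
    qed
  next
    fix k assume "k \<in> ?c ` automorphisms s"
    then show "k \<in> iso_maps s t"
      using is_iso_restrict[OF s is_iso_comp[OF _ f]] by (auto simp: automorphisms_def)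
  next
    fix k assume k: "k \<in> iso_maps s t"
    let ?h = "\<lambda>x. if x \<in> verts s then (?g \<circ> k) x else x"
    have ki: "is_iso k s t" using k by (simp add: iso_maps_def)
    then have h: "?h \<in> automorphisms s" using automorphismI[OF s is_iso_comp[OF _ g]] by blast
    have "k x \<in> verts t" if "x \<in> verts s" for x
      using ki that by (auto simp: is_iso_def dest: bij_betwE)
    then have "k = ?c ?h" using k b
      by (auto simp: iso_maps_def extensional_def restrict_def bij_betw_inv_into_right intro!: ext)
    then show "k \<in> ?c ` automorphisms s" using h by blast
  qed
  then show ?thesis by (simp add: bij_betw_same_card)
qed

lemma card_iso_maps_target:
  assumes s: "rt s \<in> verts s" and i: "s \<simeq> t"
  shows "card (iso_maps s t) = card (automorphisms t)"
proof -
  obtain f where f: "is_iso f s t" using i by (auto simp: iso_def)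
  let ?g = "inv_into (verts s) f"
  have b: "bij_betw f (verts s) (verts t)" using f by (simp add: is_iso_def)
  have g: "is_iso ?g t s" using f s by (rule is_iso_inv)
  have t: "rt t \<in> verts t" using f b s by (metis bij_betwE is_iso_def)
  let ?c = "\<lambda>h. restrict (h \<circ> f) (verts s)"
  have "bij_betw ?c (automorphisms t) (iso_maps s t)"
  proof (intro bij_betw_imageI inj_onI subset_antisym subsetI)
    fix h k assume h: "h \<in> automorphisms t" and k: "k \<in> automorphisms t" and eq: "?c h = ?c k"
    have p: "h permutes verts t" "k permutes verts t" using h k by (auto simp: automorphisms_def)
    show "h = k"
    proof
      fix y show "h y = k y"
      proof (cases "y \<in> verts t")
        case True
        then obtain x where "x \<in> verts s" "y = f x" using b by (auto simp: bij_betw_def)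
        then show ?thesis using fun_cong[OF eq, of x] by simp
      next
        case False
        then show ?thesis using p by (simp add: permutes_not_in)
      qed
    qed
  next
    fix k assume "k \<in> ?c ` automorphisms t"
    then show "k \<in> iso_maps s t"
      using is_iso_restrict[OF s is_iso_comp[OF f]] by (auto simp: automorphisms_def)
  next
    fix k assume k: "k \<in> iso_maps s t"
    let ?h = "\<lambda>y. if y \<in> verts t then (k \<circ> ?g) y else y"
    have ki: "is_iso k s t" using k by (simp add: iso_maps_def)
    then have h: "?h \<in> automorphisms t" using automorphismI[OF t is_iso_comp[OF g]] by blast
    have "f x \<in> verts t \<and> ?g (f x) = x" if "x \<in> verts s" for x
      using b that by (auto simp: bij_betw_def)
    then have "k = ?c ?h" using k
      by (auto simp: iso_maps_def extensional_def restrict_def intro!: ext)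
    then show "k \<in> ?c ` automorphisms t" using h by blast
  qed
  then show ?thesis by (simp add: bij_betw_same_card)
qed

section \<open>The two parts of a tree cut at an edge\<close>

lemma rt_R_part:
  assumes "rooted_tree t"
  shows "rt (R_part e t) = rt t"
proof -
  have "gdist t (rt t) (rt t) = 0" unfolding gdist_def by (rule Least_eq_0) simp
  moreover obtain w where "w \<in> root_side e t"
    and w: "\<forall>y \<in> root_side e t. y \<noteq> w \<longrightarrow> gdist t (rt t) w < gdist t (rt t) y"
    using unique_min_R[OF assms refl] by blast
  moreover have "rt t \<in> root_side e t" using assms rooted_treeD(2) by (auto simp: root_side_def)
  ultimately show ?thesis
    using arg_min_on_unique[of w "root_side e t" "gdist t (rt t)"]
    by (auto simp: R_part_def rooted_subtree_def)
qed

text \<open>A path from the root enters the far part through the edge \<open>e\<close>, hence the end of \<open>e\<close> in the far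
  part is nearer to the root than every other vertex of that part.\<close>

lemma rt_P_part:
  assumes t: "rooted_tree t" and w: "w \<in> e" "w \<in> verts t - root_side e t"
  shows "rt (P_part e t) = w"
proof -
  let ?W = "verts t - root_side e t"
  obtain m where m: "m \<in> ?W" "\<forall>y \<in> ?W. y \<noteq> m \<longrightarrow> gdist t (rt t) m < gdist t (rt t) y"
    using unique_min_P[OF t refl] w(2) by blast
  obtain k u where u: "k \<le> gdist t (rt t) m" "u \<in> e" "u \<in> ?W" "e - {u} \<subseteq> root_side e t"
      "(rt t, u) \<in> adj (edges t) ^^ k"
    using walk_crosses[OF t gdist_walk[OF t], of m e] m(1) by auto
  have "gdist t (rt t) u \<le> k" unfolding gdist_def using u(5) by (rule Least_le)
  then have "u = m" using u(1,3) m(2) by force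
  moreover have "u = w" using u w by blast
  ultimately show ?thesis using arg_min_on_unique[OF m] by (simp add: P_part_def rooted_subtree_def)
qed

text \<open>A walk from the root to a vertex off the root side has to use \<open>e\<close>.\<close>

lemma cut_edge_ends:
  assumes t: "rooted_tree t" and e: "e \<in> edges t" and ne: "verts t - root_side e t \<noteq> {}"
  obtains x y where "e = {x, y}" "x \<in> root_side e t" "y \<in> verts t - root_side e t"
proof -
  obtain z where "z \<in> verts t - root_side e t" using ne by auto
  then obtain w where w: "w \<in> e" "w \<in> verts t - root_side e t" "e - {w} \<subseteq> root_side e t"
    using walk_crosses[OF t gdist_walk[OF t], of z e] by auto
  obtain a b where "e = {a, b}" "a \<noteq> b" using rooted_treeD(4)[OF t e] by auto
  then have "e = {a, b}" "w = a \<and> b \<in> root_side e t \<or> w = b \<and> a \<in> root_side e t"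
    using w by auto
  then show thesis using w(2) that[of a b] that[of b a] by (metis insert_commute)
qed

lemma crossing_edge:
  assumes e: "{a, b} \<in> edges t" and a: "a \<in> root_side e t" and b: "b \<in> verts t - root_side e t"
  shows "{a, b} = e"
proof (rule ccontr)
  assume "{a, b} \<noteq> e"
  then have "(a, b) \<in> adj (edges t - {e})" using e by (simp add: adj_def)
  then have "b \<in> root_side e t" using a b
    by (auto simp: root_side_def intro: rtrancl_into_rtrancl)
  then show False using b by simp
qed

section \<open>Isomorphisms out of a graft\<close>

text \<open>This makes a graft isomorphic to a tree a tree, so that what is known about trees cut at an edge
  applies to the graft itself.\<close>

lemma rooted_tree_iso:
  assumes t: "rooted_tree t" and f: "is_iso f s t" and s: "rt s \<in> verts s"
    and e: "\<And>e. e \<in> edges s \<Longrightarrow> e \<subseteq> verts s \<and> card e = 2"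
  shows "rooted_tree s"
proof -
  let ?g = "inv_into (verts s) f"
  have b: "bij_betw f (verts s) (verts t)"
    and edge: "\<And>x y. x \<in> verts s \<Longrightarrow> y \<in> verts s \<Longrightarrow> {x, y} \<in> edges s \<longleftrightarrow> {f x, f y} \<in> edges t"
    using f by (auto simp: is_iso_def)
  have g: "is_iso ?g t s" using f s by (rule is_iso_inv)
  have walk: "(?g x, ?g y) \<in> (adj (edges s))\<^sup>*" if "(x, y) \<in> (adj (edges t))\<^sup>*" for x y
    using that
  proof (induction rule: rtrancl_induct)
    case (step y z)
    then have yz: "{y, z} \<in> edges t" by (simp add: adj_def)
    then have "y \<in> verts t" "z \<in> verts t" using rooted_treeD(3)[OF t] by auto
    then have "{?g y, ?g z} \<in> edges s" using g yz by (auto simp: is_iso_def)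
    then have "(?g y, ?g z) \<in> adj (edges s)" by (simp add: adj_def)
    then show ?case using step.IH by (rule rtrancl_into_rtrancl[rotated])
  qed simp
  have conn: "(x, y) \<in> (adj (edges s))\<^sup>*" if "x \<in> verts s" "y \<in> verts s" for x y
  proof -
    have "f x \<in> verts t" "f y \<in> verts t" "?g (f x) = x" "?g (f y) = y"
      using b that by (auto simp: bij_betw_def)
    then show ?thesis using walk[OF rooted_treeD(5)[OF t, of "f x" "f y"]] by simp
  qed
  have "\<not> is_cycle (edges s) vs" for vs
  proof
    assume c: "is_cycle (edges s) vs"
    have iv: "vs ! i \<in> verts s" if "i < length vs" for i
    proof -
      have "{vs ! i, vs ! (Suc i mod length vs)} \<in> edges s" using c that by (simp add: is_cycle_def)
      then show ?thesis using e by blast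
    qed
    then have "set vs \<subseteq> verts s" by (auto simp: in_set_conv_nth)
    then have "distinct (map f vs)"
      using c b by (auto simp: is_cycle_def distinct_map bij_betw_def intro: inj_on_subset)
    moreover have "{map f vs ! i, map f vs ! (Suc i mod length (map f vs))} \<in> edges t"
      if "i < length vs" for i
    proof -
      have "Suc i mod length vs < length vs" using that by (intro mod_less_divisor) auto
      moreover have "{vs ! i, vs ! (Suc i mod length vs)} \<in> edges s"
        using c that by (simp add: is_cycle_def)
      ultimately show ?thesis using that edge[OF iv iv, of i "Suc i mod length vs"] by simp
    qed
    ultimately have "is_cycle (edges t) (map f vs)" using c by (simp add: is_cycle_def)
    then show False using t by (auto simp: rooted_tree_def)
  qed
  moreover have "finite (verts s)" using b rooted_treeD(1)[OF t] by (simp add: bij_betw_finite)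
  ultimately show ?thesis using s e conn by (auto simp: rooted_tree_def)
qed

lemma verts_graft: "verts (graft s v t) = Inl ` verts s \<union> Inr ` verts t"
  by (simp add: graft_def)

lemma rt_graft: "rt (graft s v t) = Inl (rt s)"
  by (simp add: graft_def)

lemma graft_edges_subset:
  assumes "rooted_tree s" "rooted_tree t" "v \<in> verts s" "e \<in> edges (graft s v t)"
  shows "e \<subseteq> verts (graft s v t) \<and> card e = 2"
proof -
  consider "e = {Inl v, Inr (rt t)}" | a where "a \<in> edges s" "e = Inl ` a"
    | a where "a \<in> edges t" "e = Inr ` a"
    using assms(4) by (auto simp: graft_def)
  then show ?thesis
  proof cases
    case 1
    then show ?thesis using assms rooted_treeD(2) by (auto simp: verts_graft)
  next
    case 2
    then have "a \<subseteq> verts s" "card a = 2" using assms(1) by (auto simp: rooted_tree_def)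
    then show ?thesis using 2 by (auto simp: verts_graft card_image)
  next
    case 3
    then have "a \<subseteq> verts t" "card a = 2" using assms(2) by (auto simp: rooted_tree_def)
    then show ?thesis using 3 by (auto simp: verts_graft card_image)
  qed
qed

text \<open>Without the new edge no edge leaves the copy of \<open>s\<close>.\<close>

lemma root_side_graft:
  assumes s: "rooted_tree s" and t: "rooted_tree t"
  shows "root_side {Inl v, Inr (rt t)} (graft s v t) = Inl ` verts s"
proof -
  let ?E = "edges (graft s v t) - {{Inl v, Inr (rt t)}}"
  have "(Inl x, Inl y) \<in> (adj ?E)\<^sup>*" if "(x, y) \<in> (adj (edges s))\<^sup>*" for x y
    using that
  proof (induction rule: rtrancl_induct)
    case (step y z)
    then have "(Inl y, Inl z) \<in> adj ?E"
      by (auto simp: adj_def graft_edge_iff doubleton_eq_iff)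
    then show ?case using step.IH by (rule rtrancl_into_rtrancl[rotated])
  qed simp
  then have sup: "(Inl (rt s), Inl y) \<in> (adj ?E)\<^sup>*" if "y \<in> verts s" for y
    using that rooted_treeD(2,5)[OF s] by blast
  have "y \<in> range Inl" if "(Inl x, y) \<in> (adj ?E)\<^sup>*" for x y
    using that
  proof (induction rule: rtrancl_induct)
    case (step y z)
    then obtain a where "y = Inl a" by auto
    then show ?case using step.hyps(2) graft_edge_iff(3)[OF s t]
      by (cases z) (auto simp: adj_def)
  qed simp
  then have sub: "(Inl (rt s), Inr y) \<notin> (adj ?E)\<^sup>*" for y by blast
  show ?thesis unfolding root_side_def verts_graft rt_graft using sup sub by blast
qed

lemma graft_parts:
  assumes s: "rooted_tree s" and t: "rooted_tree t" and g: "rooted_tree (graft s v t)"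
  shows "is_iso Inl s (R_part {Inl v, Inr (rt t)} (graft s v t))"
    and "is_iso Inr t (P_part {Inl v, Inr (rt t)} (graft s v t))"
proof -
  let ?e = "{Inl v, Inr (rt t)}" and ?g = "graft s v t"
  have rs: "root_side ?e ?g = Inl ` verts s" by (rule root_side_graft[OF s t])
  have P: "verts ?g - root_side ?e ?g = Inr ` verts t" unfolding rs by (auto simp: verts_graft)
  have vR: "verts (R_part ?e ?g) = Inl ` verts s"
    "edges (R_part ?e ?g) = {a \<in> edges ?g. a \<subseteq> Inl ` verts s}"
    by (simp_all add: R_part_def rooted_subtree_def rs)
  have vP: "verts (P_part ?e ?g) = Inr ` verts t"
    "edges (P_part ?e ?g) = {a \<in> edges ?g. a \<subseteq> Inr ` verts t}"
    by (simp_all add: P_part_def rooted_subtree_def P)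
  have "rt (P_part ?e ?g) = Inr (rt t)"
    by (rule rt_P_part[OF g]) (use P rooted_treeD(2)[OF t] in auto)
  then show "is_iso Inr t (P_part ?e ?g)"
    unfolding is_iso_def vP bij_betw_def by (simp add: graft_edge_iff(2))
  have "rt (R_part ?e ?g) = Inl (rt s)" unfolding rt_R_part[OF g] by (rule rt_graft)
  then show "is_iso Inl s (R_part ?e ?g)"
    unfolding is_iso_def vR bij_betw_def by (simp add: graft_edge_iff(1))
qed

text \<open>All edges of \<open>t\<close> other than \<open>e\<close> stay within one part, and \<open>e\<close> joins the root of the far part
  to a vertex of the root side. The preimage of that vertex is where \<open>r\<close> has to be attached.\<close>

lemma glue_isos:
  assumes t: "rooted_tree t" and s: "rooted_tree s" and r: "rooted_tree r" and e: "e \<in> edges t"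
    and f: "is_iso f s (R_part e t)" and g: "is_iso g r (P_part e t)"
  obtains v where "v \<in> verts s" "e = {f v, g (rt r)}" "is_iso (case_sum f g) (graft s v r) t"
proof -
  have R: "verts (R_part e t) = root_side e t"
    and P: "verts (P_part e t) = verts t - root_side e t"
    by (simp_all add: R_part_def P_part_def rooted_subtree_def)
  have bf: "bij_betw f (verts s) (root_side e t)"
    and bg: "bij_betw g (verts r) (verts t - root_side e t)"
    using f g by (auto simp: is_iso_def R P)
  have fm: "f a \<in> root_side e t" if "a \<in> verts s" for a using bf that by (auto dest: bij_betwE)
  have gm: "g a \<in> verts t - root_side e t" if "a \<in> verts r" for a using bg that by (auto dest: bij_betwE)
  obtain x y where xy: "e = {x, y}" "x \<in> root_side e t" "y \<in> verts t - root_side e t"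
    using cut_edge_ends[OF t e] gm[OF rooted_treeD(2)[OF r]] by blast
  obtain v where v: "v \<in> verts s" "f v = x" using bf xy(2) by (metis bij_betw_def imageE)
  have y: "g (rt r) = y"
    using rt_P_part[OF t, of y e] xy g by (simp add: is_iso_def)
  have fe: "{a, b} \<in> edges s \<longleftrightarrow> {f a, f b} \<in> edges t" if "a \<in> verts s" "b \<in> verts s" for a b
    using f that fm by (auto simp: is_iso_def R_part_def rooted_subtree_def)
  have ge: "{a, b} \<in> edges r \<longleftrightarrow> {g a, g b} \<in> edges t" if "a \<in> verts r" "b \<in> verts r" for a b
    using g that gm by (auto simp: is_iso_def P_part_def rooted_subtree_def)
  have mixed: "{Inl a, Inr b} \<in> edges (graft s v r) \<longleftrightarrow> {f a, g b} \<in> edges t"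
    if ab: "a \<in> verts s" "b \<in> verts r" for a b
  proof -
    have "{f a, g b} \<in> edges t \<longleftrightarrow> {f a, g b} = {x, y}"
      using crossing_edge[OF _ fm[OF ab(1)] gm[OF ab(2)]] e xy(1) by auto
    also have "\<dots> \<longleftrightarrow> f a = f v \<and> g b = g (rt r)"
      using fm[OF ab(1)] gm[OF ab(2)] xy v y by (auto simp: doubleton_eq_iff)
    also have "\<dots> \<longleftrightarrow> a = v \<and> b = rt r"
      using inj_on_eq_iff[OF bij_betw_imp_inj_on[OF bf] ab(1) v(1)]
        inj_on_eq_iff[OF bij_betw_imp_inj_on[OF bg] ab(2) rooted_treeD(2)[OF r]] by simp
    finally show ?thesis by (simp add: graft_edge_iff(3)[OF s r])
  qed
  have "bij_betw (case_sum f g) (verts (graft s v r)) (verts t)"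
  proof -
    have "bij_betw (case_sum f g) (Inl ` verts s) (root_side e t)"
      using bf by (auto simp: bij_betw_def inj_on_def image_image)
    moreover have "bij_betw (case_sum f g) (Inr ` verts r) (verts t - root_side e t)"
      using bg by (auto simp: bij_betw_def inj_on_def image_image)
    ultimately have "bij_betw (case_sum f g) (Inl ` verts s \<union> Inr ` verts r)
        (root_side e t \<union> (verts t - root_side e t))"
      by (rule bij_betw_combine) auto
    moreover have "root_side e t \<union> (verts t - root_side e t) = verts t" by (auto simp: root_side_def)
    ultimately show ?thesis by (simp add: verts_graft)
  qed
  moreover have "case_sum f g (rt (graft s v r)) = rt t"
    using f rt_R_part[OF t] by (simp add: rt_graft is_iso_def)
  moreover have "{a, b} \<in> edges (graft s v r) \<longleftrightarrow> {case_sum f g a, case_sum f g b} \<in> edges t"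
    if "a \<in> verts (graft s v r)" "b \<in> verts (graft s v r)" for a b
    using that fe ge mixed
    by (cases a; cases b) (auto simp: verts_graft graft_edge_iff(1,2) insert_commute)
  ultimately have "is_iso (case_sum f g) (graft s v r) t" by (simp add: is_iso_def)
  then show thesis using that v xy(1) y by simp
qed

text \<open>An isomorphism out of a graft amounts to the image of the new edge together with the
  restrictions to both sides. The vertex \<open>v\<close> is not recorded in the image of the pair, but it is
  recovered from the image of the new edge.\<close>

lemma graft_iso_bij:
  assumes t: "rooted_tree t" and s: "rooted_tree s" and r: "rooted_tree r"
  shows "bij_betw
    (\<lambda>(v, \<phi>). (\<phi> ` {Inl v, Inr (rt r)}, restrict (\<phi> \<circ> Inl) (verts s), restrict (\<phi> \<circ> Inr) (verts r)))
    (SIGMA v : verts s. iso_maps (graft s v r) t)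
    (SIGMA e : edges t. iso_maps s (R_part e t) \<times> iso_maps r (P_part e t))"
    (is "bij_betw ?F ?A ?B")
proof (intro bij_betw_imageI inj_onI subset_antisym subsetI)
  fix p q assume p: "p \<in> ?A" and q: "q \<in> ?A" and eq: "?F p = ?F q"
  obtain v \<phi> w \<psi> where pq: "p = (v, \<phi>)" "q = (w, \<psi>)" by (cases p; cases q)
  have v: "v \<in> verts s" "w \<in> verts s"
    and i: "\<phi> \<in> iso_maps (graft s v r) t" "\<psi> \<in> iso_maps (graft s w r) t"
    using p q pq by auto
  have "\<phi> (Inl a) = \<psi> (Inl a)" if "a \<in> verts s" for a
  proof -
    have "restrict (\<phi> \<circ> Inl) (verts s) = restrict (\<psi> \<circ> Inl) (verts s)"
      using eq by (simp add: pq)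
    from fun_cong[OF this, of a] show ?thesis using that by simp
  qed
  moreover have "\<phi> (Inr a) = \<psi> (Inr a)" if "a \<in> verts r" for a
  proof -
    have "restrict (\<phi> \<circ> Inr) (verts r) = restrict (\<psi> \<circ> Inr) (verts r)"
      using eq by (simp add: pq)
    from fun_cong[OF this, of a] show ?thesis using that by simp
  qed
  ultimately have on: "\<phi> x = \<psi> x" if "x \<in> Inl ` verts s \<union> Inr ` verts r" for x using that by auto
  have "\<phi> = \<psi>"
    using i on unfolding iso_maps_def verts_graft by (blast intro: extensionalityI)
  moreover have inj: "inj_on \<phi> (Inl ` verts s \<union> Inr ` verts r)"
    using i by (simp add: iso_maps_def is_iso_def bij_betw_def verts_graft)
  moreover have "\<phi> ` {Inl v, Inr (rt r)} = \<phi> ` {Inl w, Inr (rt r)}"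
    using eq \<open>\<phi> = \<psi>\<close> by (simp add: pq)
  then have "{Inl v, Inr (rt r)} = {Inl w, Inr (rt r)}"
    by (subst (asm) inj_on_image_eq_iff[OF inj]) (use v rooted_treeD(2)[OF r] in auto)
  ultimately show "p = q" by (simp add: pq doubleton_eq_iff)
next
  fix q assume "q \<in> ?F ` ?A"
  then obtain v \<phi> where v: "v \<in> verts s" and \<phi>: "is_iso \<phi> (graft s v r) t"
    and q: "q = ?F (v, \<phi>)" by (auto simp: iso_maps_def)
  \<comment> \<open>The graft is cut at its new edge, and the two parts are transported along \<open>\<phi>\<close>.\<close>
  let ?g = "graft s v r" and ?e = "{Inl v, Inr (rt r)}"
  have g: "rooted_tree ?g"
    using rooted_tree_iso[OF t \<phi> _ graft_edges_subset[OF s r v]] rooted_treeD(2)[OF s]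
    by (simp add: verts_graft rt_graft)
  have e: "?e \<in> edges ?g" by (simp add: graft_def)
  have "Inr (rt r) \<in> verts ?g - root_side ?e ?g"
    using rooted_treeD(2)[OF r] by (auto simp: root_side_graft[OF s r] verts_graft)
  then have ne: "verts ?g - root_side ?e ?g \<noteq> {}" by blast
  have "is_iso (\<phi> \<circ> Inl) s (R_part (\<phi> ` ?e) t)"
    using is_iso_comp[OF graft_parts(1)[OF s r g] R_part_iso[OF g t \<phi> e]] .
  moreover have "is_iso (\<phi> \<circ> Inr) r (P_part (\<phi> ` ?e) t)"
    using is_iso_comp[OF graft_parts(2)[OF s r g] P_part_iso[OF g t \<phi> e ne]] .
  ultimately show "q \<in> ?B"
    using is_iso_restrict[OF rooted_treeD(2)[OF s]] is_iso_restrict[OF rooted_treeD(2)[OF r]]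
      iso_image_edge[OF g t \<phi> e] unfolding q prod.case by blast
next
  fix q assume "q \<in> ?B"
  then obtain e f h where q: "q = (e, f, h)" and e: "e \<in> edges t"
    and f: "f \<in> iso_maps s (R_part e t)" and h: "h \<in> iso_maps r (P_part e t)" by auto
  have fh: "is_iso f s (R_part e t)" "is_iso h r (P_part e t)" using f h by (auto simp: iso_maps_def)
  obtain v where v: "v \<in> verts s" "e = {f v, h (rt r)}" "is_iso (case_sum f h) (graft s v r) t"
    using glue_isos[OF t s r e fh] .
  let ?\<phi> = "restrict (case_sum f h) (verts (graft s v r))"
  have "rt (graft s v r) \<in> verts (graft s v r)"
    using rooted_treeD(2)[OF s] by (simp add: rt_graft verts_graft)
  then have "?\<phi> \<in> iso_maps (graft s v r) t" using v(3) by (rule is_iso_restrict)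
  moreover have "?F (v, ?\<phi>) = q"
    using f h v(1,2) rooted_treeD(2)[OF r]
    by (auto simp: q verts_graft iso_maps_def extensional_def restrict_def intro!: ext)
  ultimately show "q \<in> ?F ` ?A" using v(1) by (intro image_eqI[of _ _ "(v, ?\<phi>)"]) auto
qed

text \<open>Both sides count the isomorphisms out of grafts of \<open>r\<close> onto \<open>s\<close>: on the right by the point of
  attachment, on the left by the image of the new edge.\<close>

lemma graph_alpha_beta:
  assumes t: "rooted_tree t" and s: "rooted_tree s" and r: "rooted_tree r"
  shows "card (automorphisms r) * card (automorphisms s) *
      card {e \<in> edges t. R_part e t \<simeq> s \<and> P_part e t \<simeq> r} =
    card (automorphisms t) * card {v \<in> verts s. t \<simeq> graft s v r}"
proof -
  let ?A = "SIGMA v : verts s. iso_maps (graft s v r) t"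
  let ?B = "SIGMA e : edges t. iso_maps s (R_part e t) \<times> iso_maps r (P_part e t)"
  let ?a = "\<lambda>e. R_part e t \<simeq> s \<and> P_part e t \<simeq> r"
  have fs: "finite (verts s)" using rooted_treeD(1)[OF s] .
  have "edges t \<subseteq> Pow (verts t)" using rooted_treeD(3)[OF t] by auto
  then have ft: "finite (edges t)" using rooted_treeD(1)[OF t] by (simp add: finite_subset)
  have grt: "rt (graft s v r) \<in> verts (graft s v r)" for v
    using rooted_treeD(2)[OF s] by (simp add: rt_graft verts_graft)
  have cA: "card (iso_maps (graft s v r) t) =
      (if t \<simeq> graft s v r then card (automorphisms t) else 0)" for v
    using card_iso_maps_target[OF grt] iso_maps_empty iso_sym[OF grt] iso_sym[OF rooted_treeD(2)[OF t]]
    by (metis card.empty)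
  have cB: "card (iso_maps s (R_part e t) \<times> iso_maps r (P_part e t)) =
      (if ?a e then card (automorphisms r) * card (automorphisms s) else 0)" for e
  proof (cases "s \<simeq> R_part e t \<and> r \<simeq> P_part e t")
    case True
    then have "?a e" using iso_sym[OF rooted_treeD(2)[OF s]] iso_sym[OF rooted_treeD(2)[OF r]] by blast
    moreover have "card (iso_maps s (R_part e t)) = card (automorphisms s)"
      "card (iso_maps r (P_part e t)) = card (automorphisms r)"
      using True by (simp_all add: card_iso_maps_source rooted_treeD(2)[OF s] rooted_treeD(2)[OF r])
    ultimately show ?thesis by (simp add: card_cartesian_product)
  next
    case False
    have Rr: "rt (R_part e t) \<in> verts (R_part e t)"
      using rt_R_part[OF t] rooted_treeD(2)[OF t]
      by (simp add: R_part_def rooted_subtree_def root_side_def)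
    have Pr: "rt (P_part e t) \<in> verts (P_part e t)" if "P_part e t \<simeq> r"
    proof -
      have ne: "verts t - root_side e t \<noteq> {}"
        using that rooted_treeD(2)[OF r]
        by (auto simp: iso_def is_iso_def P_part_def rooted_subtree_def bij_betw_def)
      show ?thesis using arg_min_on_mem[OF unique_min_P[OF t refl ne]]
        by (simp add: P_part_def rooted_subtree_def)
    qed
    have "\<not> ?a e" using False iso_sym[OF Rr, of s] iso_sym[OF Pr, of r] by blast
    moreover have "iso_maps s (R_part e t) = {} \<or> iso_maps r (P_part e t) = {}"
      using False iso_maps_empty[of s] iso_maps_empty[of r] by blast
    ultimately show ?thesis by auto
  qed
  have "finite (iso_maps (graft s v r) t)" for v
    using fs rooted_treeD(1)[OF r] by (simp add: finite_iso_maps verts_graft)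
  then have "card ?A = (\<Sum>v\<in>verts s. card (iso_maps (graft s v r) t))"
    using fs by simp
  also have "\<dots> = card (automorphisms t) * card {v \<in> verts s. t \<simeq> graft s v r}"
    by (simp add: cA sum.If_cases[OF fs] Int_def)
  finally have A: "card ?A = card (automorphisms t) * card {v \<in> verts s. t \<simeq> graft s v r}" .
  have "finite (iso_maps s (R_part e t) \<times> iso_maps r (P_part e t))" for e
    using fs rooted_treeD(1)[OF r] by (simp add: finite_iso_maps)
  then have "card ?B = (\<Sum>e\<in>edges t. card (iso_maps s (R_part e t) \<times> iso_maps r (P_part e t)))"
    using ft by (intro card_SigmaI) auto
  also have "\<dots> = card (automorphisms r) * card (automorphisms s) * card {e \<in> edges t. ?a e}"
    by (simp add: cB sum.If_cases[OF ft] Int_def)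
  finally show ?thesis using A bij_betw_same_card[OF graft_iso_bij[OF t s r]] by simp
qed

section \<open>The structure constants\<close>

lemma alpha_beta:
  "num_aut r * num_aut s * alpha r t s = num_aut t * beta t r s"
proof transfer
  fix r s t :: "nat rgraph"
  assume "rooted_tree r \<and> rooted_tree r \<and> r \<simeq> r" "rooted_tree s \<and> rooted_tree s \<and> s \<simeq> s"
    "rooted_tree t \<and> rooted_tree t \<and> t \<simeq> t"
  then show "card (automorphisms r) * card (automorphisms s) *
      card {e \<in> edges t. R_part e t \<simeq> s \<and> P_part e t \<simeq> r} =
    card (automorphisms t) * card {v \<in> verts s. t \<simeq> graft s v r}"
    by (intro graph_alpha_beta) blast+
qed

lemma num_aut_nonzero [simp]: "num_aut t \<noteq> 0"
proof transfer
  fix t :: "nat rgraph" assume "rooted_tree t \<and> rooted_tree t \<and> t \<simeq> t"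
  then have "finite (automorphisms t)"
    by (simp add: automorphisms_def finite_permutations rooted_treeD(1))
  moreover have "id \<in> automorphisms t" by (simp add: automorphisms_def permutes_id is_iso_id)
  ultimately show "card (automorphisms t) \<noteq> 0" by (auto simp: card_gt_0_iff)
qed

lemma alpha_eq_beta:
  "(of_nat (alpha r t s) :: complex) = of_nat (num_aut t) * of_nat (beta t r s) /
     (of_nat (num_aut r) * of_nat (num_aut s))"
proof -
  have "(of_nat (num_aut r) * of_nat (num_aut s) * of_nat (alpha r t s) :: complex) =
      of_nat (num_aut t) * of_nat (beta t r s)"
    using alpha_beta[of r s t] by (metis of_nat_mult)
  then show ?thesis by (simp add: field_simps)
qed

section \<open>Linear maps between free vector spaces\<close>

lemma lookup_cscale: "Poly_Mapping.lookup (cscale c x) b = c * Poly_Mapping.lookup x b"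
  by (simp add: cscale_def map.rep_eq when_def)

interpretation cs: vector_space cscale
  by unfold_locales (auto intro!: poly_mapping_eqI simp: lookup_cscale lookup_add algebra_simps)

abbreviation clinear :: "(('b \<Rightarrow>\<^sub>0 complex) \<Rightarrow> ('c \<Rightarrow>\<^sub>0 complex)) \<Rightarrow> bool" where
  "clinear \<equiv> Vector_Spaces.linear cscale cscale"

lemma clinearI:
  assumes "\<And>x y. f (x + y) = f x + f y" "\<And>c x. f (cscale c x) = cscale c (f x)"
  shows "clinear f"
  using assms by (simp add: Vector_Spaces.linear_def module_hom_def module_hom_axioms_def
      cs.vector_space_axioms cs.module_axioms)

lemma clinearD:
  assumes "clinear f"
  shows "f (x + y) = f x + f y" "f (cscale c x) = cscale c (f x)" "f 0 = 0" "f (- x) = - f x"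
    "f (sum g A) = (\<Sum>a\<in>A. f (g a))"
proof -
  interpret Vector_Spaces.linear cscale cscale f by (rule assms)
  show "f (x + y) = f x + f y" "f (cscale c x) = cscale c (f x)" "f 0 = 0" "f (- x) = - f x"
    "f (sum g A) = (\<Sum>a\<in>A. f (g a))"
    by (simp_all add: add scale zero neg sum)
qed

lemma clinear_comp: "clinear f \<Longrightarrow> clinear g \<Longrightarrow> clinear (\<lambda>x. f (g x))"
  by (rule clinearI) (simp_all add: clinearD)

lemma clinear_cscale: "clinear (cscale c)"
  by (rule clinearI) (simp_all add: cs.scale_right_distrib mult.commute)

lemma linear_ext_superset:
  assumes "finite K" "Poly_Mapping.keys x \<subseteq> K"
  shows "linear_ext f x = (\<Sum>b\<in>K. cscale (Poly_Mapping.lookup x b) (f b))"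
  unfolding linear_ext_def using assms
  by (intro sum.mono_neutral_left) (auto simp: in_keys_iff)

lemma clinear_linear_ext: "clinear (linear_ext f)"
proof (rule clinearI)
  fix x y :: "'a \<Rightarrow>\<^sub>0 complex" and c :: complex
  have "linear_ext f (x + y) = (\<Sum>b\<in>Poly_Mapping.keys x \<union> Poly_Mapping.keys y.
      cscale (Poly_Mapping.lookup (x + y) b) (f b))"
    using keys_add[of x y] by (intro linear_ext_superset) auto
  also have "\<dots> = linear_ext f x + linear_ext f y"
    using linear_ext_superset[of "Poly_Mapping.keys x \<union> Poly_Mapping.keys y" _ f]
    by (simp add: lookup_add cs.scale_left_distrib sum.distrib)
  finally show "linear_ext f (x + y) = linear_ext f x + linear_ext f y" .
  have "linear_ext f (cscale c x) =
      (\<Sum>b\<in>Poly_Mapping.keys x. cscale (Poly_Mapping.lookup (cscale c x) b) (f b))"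
    by (intro linear_ext_superset) (auto simp: in_keys_iff lookup_cscale)
  then show "linear_ext f (cscale c x) = cscale c (linear_ext f x)"
    by (simp add: lookup_cscale linear_ext_def cs.scale_sum_right)
qed

lemma linear_ext_single: "linear_ext f (Poly_Mapping.single b c) = cscale c (f b)"
  by (simp add: linear_ext_def)

lemma basis_expansion:
  "x = (\<Sum>b\<in>Poly_Mapping.keys x. cscale (Poly_Mapping.lookup x b) (Poly_Mapping.single b 1))"
  by (rule poly_mapping_eqI)
    (simp add: lookup_sum lookup_cscale lookup_single when_def in_keys_iff if_distrib sum.delta
      cong: if_cong)

lemma clinear_eqI:
  assumes "clinear f" "clinear g" "\<And>b. f (Poly_Mapping.single b 1) = g (Poly_Mapping.single b 1)"
  shows "f x = g x"
  by (subst (1 2) basis_expansion[of x]) (simp add: clinearD[OF assms(1)] clinearD[OF assms(2)] assms(3))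

text \<open>Injectivity makes the families \<open>g\<close> and \<open>f \<circ> g\<close> have the same support, so either both sums
  are finite or both are \<open>0\<close> by convention.\<close>

lemma Sum_any_injective_linear:
  assumes "clinear f" "inj f"
  shows "f (Sum_any g) = Sum_any (\<lambda>r. f (g r))"
proof -
  have "f y = 0 \<longleftrightarrow> y = 0" for y
    using clinearD(3)[OF assms(1)] injD[OF assms(2), of y 0] by auto
  then show ?thesis
    by (simp add: Sum_any.expand_set clinearD(5)[OF assms(1)])
qed


section \<open>The anti-involution\<close>

lemma clinear_bracket_left: "clinear (\<lambda>x. bracket x y)"
  unfolding bracket_def by (rule clinear_linear_ext)

lemma clinear_bracket_right: "clinear (bracket x)"
  by (rule clinearI)
    (simp_all add: bracket_def linear_ext_def[of _ x] clinearD[OF clinear_linear_ext]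
      cs.scale_right_distrib sum.distrib cs.scale_sum_right mult.commute)

lemma bracket_bas: "bracket (bas a) (bas b) = bracket_basis a b"
  by (simp add: bracket_def linear_ext_single)

lemma clinear_sigma: "clinear sigma"
  unfolding sigma_def by (rule clinear_linear_ext)

lemma sigma_bas: "sigma (bas b) = sigma_basis b"
  by (simp add: sigma_def linear_ext_single)

lemma sigma_sigma: "sigma (sigma x) = x"
proof (rule clinear_eqI[where f = "\<lambda>x. sigma (sigma x)" and g = "\<lambda>x. x"])
  show "sigma (sigma (bas b)) = bas b" for b
    by (cases b) (simp_all add: sigma_bas clinearD[OF clinear_sigma])
qed (auto intro: clinear_comp clinear_sigma clinearI)

lemma sigma_Sum_any: "sigma (Sum_any g) = Sum_any (\<lambda>r. sigma (g r))"
  by (rule Sum_any_injective_linear[OF clinear_sigma]) (metis injI sigma_sigma)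

lemma cscale_Sum_any:
  assumes "c \<noteq> 0"
  shows "cscale c (Sum_any g) = Sum_any (\<lambda>r. cscale c (g r))"
  using assms by (intro Sum_any_injective_linear[OF clinear_cscale]) (auto intro: injI)

text \<open>The map \<open>sigma\<close> sends the $D^+$-part of one bracket to the $D^-$-part of the other and vice versa.
  Comparing coefficients is \<open>alpha_eq_beta\<close>, once for each part.\<close>

lemma sigma_bracket_pm:
  "sigma (bracket_pm s t) = cscale (of_nat (num_aut t) / of_nat (num_aut s)) (bracket_pm t s)"
proof (cases "s = t")
  case True
  then show ?thesis by (simp add: bracket_pm_def sigma_bas)
next
  case False
  have "of_nat (alpha s t r) * of_nat (num_aut r) =
      of_nat (num_aut t) / of_nat (num_aut s) * (of_nat (beta t s r) :: complex)" for r
    by (simp add: alpha_eq_beta field_simps)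
  moreover have "of_nat (beta s t r) * inverse (of_nat (num_aut r)) =
      of_nat (num_aut t) / of_nat (num_aut s) * (of_nat (alpha t s r) :: complex)" for r
    by (simp add: alpha_eq_beta field_simps)
  ultimately show ?thesis using False
    by (simp add: bracket_pm_def clinearD[OF clinear_sigma] sigma_Sum_any sigma_bas
        cs.scale_right_distrib cscale_Sum_any add.commute)
qed

lemma sigma_bracket_bas:
  "sigma (bracket (bas a) (bas b)) = bracket (sigma (bas b)) (sigma (bas a))"
proof -
  note lin = clinearD[OF clinear_sigma] clinearD[OF clinear_bracket_left]
    clinearD[OF clinear_bracket_right] sigma_bas bracket_bas
  show ?thesis
  proof (cases a; cases b)
    fix s t assume [simp]: "a = D_plus s" "b = D_plus t"
    have "(of_nat (beta r s t) - of_nat (beta r t s)) * of_nat (num_aut r) =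
        of_nat (num_aut s) * (of_nat (num_aut t) *
          (of_nat (alpha s r t) - of_nat (alpha t r s) :: complex))"
      for r
      by (simp add: alpha_eq_beta field_simps)
    then show ?thesis by (simp add: lin sigma_Sum_any cscale_Sum_any)
  next
    fix s t assume [simp]: "a = D_minus s" "b = D_minus t"
    have "(of_nat (alpha t r s) - of_nat (alpha s r t)) * inverse (of_nat (num_aut r)) =
        inverse (of_nat (num_aut s)) * (inverse (of_nat (num_aut t)) *
          (of_nat (beta r t s) - of_nat (beta r s t) :: complex))"
      for r
      by (simp add: alpha_eq_beta field_simps)
    then show ?thesis by (simp add: lin sigma_Sum_any cscale_Sum_any)
  next
    fix s t assume [simp]: "a = D_minus s" "b = D_plus t"
    show ?thesis by (simp add: lin sigma_bracket_pm divide_inverse mult.commute)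
  next
    fix s t assume [simp]: "a = D_plus s" "b = D_minus t"
    show ?thesis by (simp add: lin sigma_bracket_pm divide_inverse mult.commute)
  qed (simp_all add: lin mult.commute)
qed

theorem proposition3p4:
  shows "anti_involution cscale bracket sigma"
proof -
  have "sigma (bracket x y) = bracket (sigma y) (sigma x)" for x y
  proof (rule clinear_eqI[where f = "\<lambda>x. sigma (bracket x y)"])
    show "clinear (\<lambda>x. sigma (bracket x y))"
      by (rule clinear_comp[OF clinear_sigma clinear_bracket_left])
    show "clinear (\<lambda>x. bracket (sigma y) (sigma x))"
      by (rule clinear_comp[OF clinear_bracket_right clinear_sigma])
    fix a
    show "sigma (bracket (bas a) y) = bracket (sigma y) (sigma (bas a))"
    proof (rule clinear_eqI[where f = "\<lambda>y. sigma (bracket (bas a) y)"])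
      show "clinear (\<lambda>y. sigma (bracket (bas a) y))"
        by (rule clinear_comp[OF clinear_sigma clinear_bracket_right])
      show "clinear (\<lambda>y. bracket (sigma y) (sigma (bas a)))"
        by (rule clinear_comp[OF clinear_bracket_left clinear_sigma])
    qed (rule sigma_bracket_bas)
  qed
  then show ?thesis
    using clinear_sigma sigma_sigma by (auto simp: anti_involution_def)
qed

end
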